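(* Let $(X,d)$ be a geodesic space. Then the following are equivalent: (1) Every unit ball graph on $X$ is strongly chordal. (2) Every unit ball graph on $X$ is chordal. (3) $X$ is an $\mathbb{R}$-tree.
   Context: All graphs are finite, simple and undirected. Geodesic space: let $(X,d)$ be a metric space. A geodesic from $x$ to $y$ is a distance-preserving map $\gamma\colon[0,d(x,y)]\to X$ with $\gamma(0)=x$, $\gamma(d(x,y))=y$; $(X,d)$ is a geodesic space if every two points are joined by a geodesic. Unit ball graph: a graph $G=(V_G,E_G)$ is a unit ball graph on $(X,d)$ if there exist $\delta>0$ (threshold) and a map $\rho\colon V_G\to X$ (realization, not required to be injective) such that for distinct $u,v\in V_G$, $\{u,v\}\in E_G$ if and only if $d(\rho(u),\rho(v))\le\delta$. Chordal: a graph is chordal if for every $n\ge4$ it has no induced subgraph isomorphic to the cycle $C_n$. Sun: for $n\ge3$, the $n$-sun is the graph on $2n$ vertices $\{v_i : i\in\mathbb{Z}/2n\mathbb{Z}\}$ such that the even-indexed vertices induce a complete graph, the odd-indexed vertices form an independent set, and an odd-indexed $v_i$ is adjacent to an even-indexed $v_j$ if and only if $i-j=\pm1$. A graph is sun-free if for every $n\ge3$ it has no induced subgraph isomorphic to the $n$-sun. Strongly chordal: chordal and sun-free. $\mathbb{R}$-tree: a geodesic space that is uniquely arc-connected, i.e. every pair of points in it is joined by a unique arc (an arc is the image of a topological embedding of a closed interval). *)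

theory Defs
  imports
    "HOL-Analysis.Analysis"
    "HOL-Library.Infinite_Typeclass"
    "Graph_Theory.Pair_Digraph"
    "Graph_Theory.Digraph_Isomorphism"
begin

text \<open>A metric space is a subset \<open>X\<close> of a type of class \<open>metric_space\<close>, with the restricted
  distance; \<open>X = UNIV\<close> and \<open>X = {}\<close> are allowed.\<close>

definition geodesic :: "'a::metric_space set \<Rightarrow> 'a \<Rightarrow> 'a \<Rightarrow> (real \<Rightarrow> 'a) \<Rightarrow> bool" where
  "geodesic X x y \<gamma> \<longleftrightarrow>
     \<gamma> \<in> {0..dist x y} \<rightarrow> X \<and>
     (\<forall>s\<in>{0..dist x y}. \<forall>t\<in>{0..dist x y}. dist (\<gamma> s) (\<gamma> t) = dist s t) \<and>
     \<gamma> 0 = x \<and> \<gamma> (dist x y) = y"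

definition geodesic_space :: "'a::metric_space set \<Rightarrow> bool" where
  "geodesic_space X \<longleftrightarrow> (\<forall>x\<in>X. \<forall>y\<in>X. \<exists>\<gamma>. geodesic X x y \<gamma>)"

text \<open>Degenerate intervals \<open>a = b\<close> are admitted, so that a point is joined to itself by exactly one
  arc, namely the singleton. For \<open>x \<noteq> y\<close> they play no role.\<close>

definition joined_by_arc :: "'a::metric_space set \<Rightarrow> 'a \<Rightarrow> 'a \<Rightarrow> 'a set \<Rightarrow> bool" where
  "joined_by_arc X x y A \<longleftrightarrow>
     (\<exists>(a::real) b f. a \<le> b \<and> embedding_map (top_of_set {a..b}) (top_of_set X) f \<and>
        f a = x \<and> f b = y \<and> A = f ` {a..b})"

definition uniquely_arc_connected :: "'a::metric_space set \<Rightarrow> bool" where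
  "uniquely_arc_connected X \<longleftrightarrow> (\<forall>x\<in>X. \<forall>y\<in>X. \<exists>!A. joined_by_arc X x y A)"

definition real_tree :: "'a::metric_space set \<Rightarrow> bool" where
  "real_tree X \<longleftrightarrow> geodesic_space X \<and> uniquely_arc_connected X"

text \<open>A finite simple undirected graph is a \<open>pair_graph\<close>: a finite, loop-free, symmetric digraph
  whose arcs are ordered pairs of vertices. An edge \<open>{u, v}\<close> is the pair of arcs \<open>(u, v)\<close>,
  \<open>(v, u)\<close>.\<close>

definition unit_ball_graph :: "'a::metric_space set \<Rightarrow> 'v pair_pre_digraph \<Rightarrow> bool" where
  "unit_ball_graph X G \<longleftrightarrow> pair_graph G \<and>
     (\<exists>\<delta>>0. \<exists>\<rho>. \<rho> \<in> pverts G \<rightarrow> X \<and>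
        (\<forall>u\<in>pverts G. \<forall>v\<in>pverts G. u \<noteq> v \<longrightarrow>
           ((u, v) \<in> parcs G \<longleftrightarrow> dist (\<rho> u) (\<rho> v) \<le> \<delta>)))"

definition has_induced_copy :: "'v pair_pre_digraph \<Rightarrow> 'w pair_pre_digraph \<Rightarrow> bool" where
  "has_induced_copy G H \<longleftrightarrow>
     (\<exists>K. induced_subgraph K (with_proj G) \<and> digraph_iso K (with_proj H))"

text \<open>For \<open>i, j < m\<close>: \<open>i - j = 1\<close> or \<open>i - j = -1\<close> modulo \<open>m\<close>.\<close>

definition cyclic_neighbours :: "nat \<Rightarrow> nat \<Rightarrow> nat \<Rightarrow> bool" where
  "cyclic_neighbours m i j \<longleftrightarrow> j = Suc i mod m \<or> i = Suc j mod m"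

definition cycle_graph :: "nat \<Rightarrow> nat pair_pre_digraph" where
  "cycle_graph n =
     \<lparr> pverts = {..<n},
       parcs = {(i, j). i < n \<and> j < n \<and> cyclic_neighbours n i j} \<rparr>"

definition sun_graph :: "nat \<Rightarrow> nat pair_pre_digraph" where
  "sun_graph n =
     \<lparr> pverts = {..<2 * n},
       parcs = {(i, j). i < 2 * n \<and> j < 2 * n \<and>
         (even i \<and> even j \<and> i \<noteq> j \<or>
          (odd i \<and> even j \<or> even i \<and> odd j) \<and> cyclic_neighbours (2 * n) i j)} \<rparr>"

definition chordal :: "'v pair_pre_digraph \<Rightarrow> bool" where
  "chordal G \<longleftrightarrow> (\<forall>n\<ge>4. \<not> has_induced_copy G (cycle_graph n))"

definition sun_free :: "'v pair_pre_digraph \<Rightarrow> bool" where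
  "sun_free G \<longleftrightarrow> (\<forall>n\<ge>3. \<not> has_induced_copy G (sun_graph n))"

definition strongly_chordal :: "'v pair_pre_digraph \<Rightarrow> bool" where
  "strongly_chordal G \<longleftrightarrow> chordal G \<and> sun_free G"

end

theory Submission
  imports Defs
begin

text \<open>In an \<open>\<real>\<close>-tree every point has a gate on every geodesic segment (concatenate at the first hitting
  point and use uniqueness of arcs), which gives the four-point condition. Under it, among finitely
  many points, one farthest from a base point is a simple vertex of the unit ball graph: its
  neighbours form a clique, and their neighbourhoods are nested by distance from the base point.
  Cycles of length at least 4 and suns have no simple vertex. Conversely, suppose that a point
  \<open>u\<close> of a geodesic is missed by a closed connected set \<open>C\<close> through its ends. For small \<open>\<delta>\<close>, a point
  \<open>v\<close> of the geodesic with \<open>dist u v = \<delta>\<close> can be reached from \<open>u\<close> by \<open>\<delta>\<close>-steps around through \<open>C\<close>,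
  and chordality gives \<open>u\<close> and \<open>v\<close> a common neighbour on the way, which does not exist. So every arc
  contains, and hence equals, the geodesic between its ends.\<close>

section \<open>Induced copies and unit ball graphs\<close>

lemma has_induced_copyE:
  assumes "has_induced_copy G H"
  obtains \<phi> where "\<phi> \<in> pverts H \<rightarrow> pverts G" "inj_on \<phi> (pverts H)"
    "\<And>u v. u \<in> pverts H \<Longrightarrow> v \<in> pverts H \<Longrightarrow> (\<phi> u, \<phi> v) \<in> parcs G \<longleftrightarrow> (u, v) \<in> parcs H"
proof -
  obtain K f where ind: "induced_subgraph K (with_proj G)"
    and iso: "pre_digraph.digraph_isomorphism K f" and H: "with_proj H = app_iso f K"
    using assms by (auto simp: has_induced_copy_def digraph_iso_def)
  interpret wf_digraph K
    using iso by (simp add: pre_digraph.digraph_isomorphism_def)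
  have sub: "verts K \<subseteq> pverts G" and arcs: "arcs K = {e \<in> parcs G. fst e \<in> verts K \<and> snd e \<in> verts K}"
    and K: "tail K = fst" "head K = snd"
    using ind by (auto simp: induced_subgraph_def subgraph_def compatible_def)
  \<comment> \<open>An isomorphism may rename arcs freely, so arcs are compared through their pairs
    of end points; in \<open>K\<close> and \<open>with_proj H\<close> an arc is that pair.\<close>
  have arcs_endsK: "arcs_ends K = arcs K"
    by (simp add: arcs_ends_def arc_to_ends_def K)
  have vertsH: "pverts H = iso_verts f ` verts K"
    using arg_cong[OF H, of verts] by simp
  have arcsH: "parcs H = (\<lambda>(u, v). (iso_verts f u, iso_verts f v)) ` arcs K"
    using arg_cong[OF H, of arcs_ends] arcs_ends_app_iso_eq[OF iso] arcs_endsK by simp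
  have inj: "inj_on (iso_verts f) (verts K)"
    using iso by (rule digraph_isomorphism_inj_on_verts)
  \<comment> \<open>The isomorphism runs from \<open>K\<close> to \<open>H\<close>, so the embedding
    of \<open>H\<close> into \<open>G\<close> is its inverse on vertices.\<close>
  let ?\<phi> = "the_inv_into (verts K) (iso_verts f)"
  show thesis
  proof
    show "?\<phi> \<in> pverts H \<rightarrow> pverts G"
      using inj sub by (auto simp: vertsH the_inv_into_f_f)
    show "inj_on ?\<phi> (pverts H)"
      unfolding vertsH using inj by (rule inj_on_the_inv_into)
    fix u v assume "u \<in> pverts H" "v \<in> pverts H"
    then obtain u' v' where u: "u' \<in> verts K" "u = iso_verts f u'" and v: "v' \<in> verts K" "v = iso_verts f v'"
      by (auto simp: vertsH)
    have "(u, v) \<in> parcs H \<longleftrightarrow> (u', v') \<in> arcs K"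
    proof
      assume "(u, v) \<in> parcs H"
      then obtain a b where ab: "(a, b) \<in> arcs K" "iso_verts f a = iso_verts f u'" "iso_verts f b = iso_verts f v'"
        by (auto simp: arcsH u v)
      moreover have "a \<in> verts K" "b \<in> verts K"
        using ab(1) arcs by auto
      ultimately show "(u', v') \<in> arcs K"
        using inj_onD[OF inj] u v by metis
    qed (auto simp: arcsH u v)
    also have "\<dots> \<longleftrightarrow> (u', v') \<in> parcs G"
      using u v by (simp add: arcs)
    finally show "(?\<phi> u, ?\<phi> v) \<in> parcs G \<longleftrightarrow> (u, v) \<in> parcs H"
      using u v inj by (simp add: the_inv_into_f_f)
  qed
qed

text \<open>The realization of \<open>G\<close> pulls back along the embedding with the same
  threshold, so excluding cycles and suns becomes a question about finitely many points of
  \<open>X\<close>.\<close>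

lemma has_induced_copy_unit_ball_graph:
  assumes "unit_ball_graph X G" "has_induced_copy G H"
  obtains \<delta> \<rho> where "\<delta> > 0" "\<rho> \<in> pverts H \<rightarrow> X"
    "\<And>u v. u \<in> pverts H \<Longrightarrow> v \<in> pverts H \<Longrightarrow> u \<noteq> v \<Longrightarrow> (u, v) \<in> parcs H \<longleftrightarrow> dist (\<rho> u) (\<rho> v) \<le> \<delta>"
proof -
  obtain \<delta> \<rho> where \<delta>: "\<delta> > 0" and \<rho>: "\<rho> \<in> pverts G \<rightarrow> X"
    and adj: "\<And>u v. u \<in> pverts G \<Longrightarrow> v \<in> pverts G \<Longrightarrow> u \<noteq> v \<Longrightarrow> (u, v) \<in> parcs G \<longleftrightarrow> dist (\<rho> u) (\<rho> v) \<le> \<delta>"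
    using assms(1) unfolding unit_ball_graph_def by metis
  obtain \<phi> where \<phi>: "\<phi> \<in> pverts H \<rightarrow> pverts G" "inj_on \<phi> (pverts H)"
    "\<And>u v. u \<in> pverts H \<Longrightarrow> v \<in> pverts H \<Longrightarrow> (\<phi> u, \<phi> v) \<in> parcs G \<longleftrightarrow> (u, v) \<in> parcs H"
    using has_induced_copyE[OF assms(2)] by metis
  show thesis
  proof
    show "\<delta> > 0" by fact
    show "\<rho> \<circ> \<phi> \<in> pverts H \<rightarrow> X"
      using \<rho> \<phi>(1) by auto
    fix u v assume uv: "u \<in> pverts H" "v \<in> pverts H" "u \<noteq> v"
    have "\<phi> u \<in> pverts G" "\<phi> v \<in> pverts G" "\<phi> u \<noteq> \<phi> v"
      using uv \<phi>(1,2) by (auto dest: inj_onD)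
    from adj[OF this] show "(u, v) \<in> parcs H \<longleftrightarrow> dist ((\<rho> \<circ> \<phi>) u) ((\<rho> \<circ> \<phi>) v) \<le> \<delta>"
      using \<phi>(3)[OF uv(1,2)] by simp
  qed
qed

text \<open>Cycles have vertices in \<open>nat\<close>, while the hypothesis on graphs concerns an
  arbitrary infinite type; an injection of \<open>nat\<close> into that type carries
  \<open>H\<close> and its realization over.\<close>

lemma unit_ball_graph_with_copy:
  fixes H :: "nat pair_pre_digraph"
  assumes H: "pair_graph H" and \<delta>: "\<delta> > 0" and \<rho>: "\<rho> \<in> pverts H \<rightarrow> X"
    and adj: "\<And>u v. u \<in> pverts H \<Longrightarrow> v \<in> pverts H \<Longrightarrow> u \<noteq> v \<Longrightarrow> (u, v) \<in> parcs H \<longleftrightarrow> dist (\<rho> u) (\<rho> v) \<le> \<delta>"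
  obtains G :: "'v::infinite pair_pre_digraph" where "unit_ball_graph X G" "has_induced_copy G H"
proof -
  interpret H: pair_graph H by fact
  obtain e :: "nat \<Rightarrow> 'v" where e: "inj e"
    using infinite_countable_subset[OF infinite_UNIV] by auto
  then have inv_e [simp]: "the_inv e (e u) = u" for u
    by (rule the_inv_f_f)
  let ?h = "\<lambda>(u, v). (e u, e v)"
  define G where "G = \<lparr>pverts = e ` pverts H, parcs = ?h ` parcs H\<rparr>"
  have sym: "(u, v) \<in> parcs H \<Longrightarrow> (v, u) \<in> parcs H" for u v
    by (rule H.arcs_symmetric)
  have "pair_graph G"
  proof
    show "e \<in> parcs G \<Longrightarrow> fst e \<in> pverts G" "e \<in> parcs G \<Longrightarrow> snd e \<in> pverts G" for e
      by (auto simp: G_def dest: H.in_arcsD1 H.in_arcsD2)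
    show "finite (pverts G)" "finite (parcs G)"
      by (simp_all add: G_def)
    show "a \<in> parcs G \<Longrightarrow> fst a \<noteq> snd a" for a
      using e H.no_loops' by (auto simp: G_def inj_eq)
    show "symmetric (with_proj G)"
      using sym by (auto simp: symmetric_def sym_def G_def image_iff split_def) (metis fst_conv snd_conv)
  qed
  have verts_G: "pverts G = e ` pverts H"
    by (simp add: G_def)
  have arc_iff: "(e u, e v) \<in> parcs G \<longleftrightarrow> (u, v) \<in> parcs H" for u v
    using e by (auto simp: G_def inj_eq)
  show thesis
  proof
    show "unit_ball_graph X G"
      unfolding unit_ball_graph_def
    proof (intro conjI exI)
      show "pair_graph G" "\<delta> > 0" by fact+
      show "\<rho> \<circ> the_inv e \<in> pverts G \<rightarrow> X"
        using \<rho> by (auto simp: G_def)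
      show "\<forall>u\<in>pverts G. \<forall>v\<in>pverts G. u \<noteq> v \<longrightarrow>
           ((u, v) \<in> parcs G \<longleftrightarrow> dist ((\<rho> \<circ> the_inv e) u) ((\<rho> \<circ> the_inv e) v) \<le> \<delta>)"
        using adj by (auto simp: arc_iff verts_G)
    qed
    interpret G: pair_graph G by fact
    have "digraph_iso (with_proj G) (with_proj H)"
      unfolding digraph_iso_def
    proof (intro exI conjI)
      let ?g = "\<lambda>(u, v). (the_inv e u, the_inv e v)"
      \<comment> \<open>The whole of \<open>G\<close> serves as the induced subgraph, and the
        isomorphism onto \<open>H\<close> is the inverse of \<open>e\<close> on vertices and on both
        components of arcs.\<close>
      let ?f = "\<lparr>iso_verts = the_inv e, iso_arcs = ?g, iso_head = snd, iso_tail = fst\<rparr>"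
      show "pre_digraph.digraph_isomorphism (with_proj G) ?f"
        unfolding pre_digraph.digraph_isomorphism_def
        using G.wf_digraph_axioms by (auto simp: G_def inj_on_def)
      show "with_proj H = app_iso ?f (with_proj G)"
        by (auto simp: app_iso_def with_proj_def G_def image_image split_def)
    qed
    then show "has_induced_copy G H"
      unfolding has_induced_copy_def using G.induced_subgraph_refl by blast
  qed
qed

section \<open>Cycles and suns under the four-point condition\<close>

lemma cyclic_neighbours_iff:
  assumes "i < m" "j < m"
  shows "cyclic_neighbours m i j \<longleftrightarrow>
    j = Suc i \<or> i = Suc j \<or> (i = 0 \<and> Suc j = m) \<or> (j = 0 \<and> Suc i = m)"
  using assms unfolding cyclic_neighbours_def by (auto simp: mod_Suc)

text \<open>For \<open>n = 1\<close> the vertex 0 would be its own cyclic neighbour, giving a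
  loop.\<close>

lemma pair_graph_cycle_graph:
  assumes "n \<ge> 2"
  shows "pair_graph (cycle_graph n)"
proof
  show "symmetric (with_proj (cycle_graph n))"
    by (auto simp: symmetric_def sym_def cycle_graph_def cyclic_neighbours_def)
  show "finite (parcs (cycle_graph n))"
    by (rule finite_subset[of _ "{..<n} \<times> {..<n}"]) (auto simp: cycle_graph_def)
  show "e \<in> parcs (cycle_graph n) \<Longrightarrow> fst e \<noteq> snd e" for e
    using assms by (auto simp: cycle_graph_def cyclic_neighbours_iff)
qed (auto simp: cycle_graph_def)

text \<open>Gromov's 0-hyperbolicity: of the three sums obtained by splitting four points into two
  pairs, the two largest coincide.\<close>

definition four_point :: "'a::metric_space set \<Rightarrow> bool" where
  "four_point X \<longleftrightarrow> (\<forall>x\<in>X. \<forall>y\<in>X. \<forall>z\<in>X. \<forall>w\<in>X.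
     dist x y + dist z w \<le> max (dist x z + dist y w) (dist x w + dist y z))"

lemma four_pointD:
  assumes "four_point X" "x \<in> X" "y \<in> X" "z \<in> X" "w \<in> X"
  shows "dist x y + dist z w \<le> dist x z + dist y w \<or> dist x y + dist z w \<le> dist x w + dist y z"
  using assms unfolding four_point_def by (metis le_max_iff_disj)

text \<open>Both alternatives for \<open>dist u w + dist r v\<close> pair a distance to
  \<open>r\<close>, at most \<open>dist r v\<close>, with a distance to \<open>v\<close>, at most
  \<delta>; cancel \<open>dist r v\<close>.\<close>

lemma four_point_simplicial:
  assumes X: "four_point X" "{r, v, u, w} \<subseteq> X"
    and deep: "dist r u \<le> dist r v" "dist r w \<le> dist r v"
    and nb: "dist u v \<le> \<delta>" "dist w v \<le> \<delta>"
  shows "dist u w \<le> \<delta>"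
  using four_pointD[OF X(1), of u w r v] assms by (auto simp: dist_commute)

text \<open>The inequality for \<open>a v w r\<close> bounds \<open>dist a v\<close> by
  \<open>\<delta> + dist r v - dist r w\<close>. With this bound, both alternatives for
  \<open>dist u a + dist r v\<close> are at most \<open>\<delta> + dist r v\<close>.\<close>

lemma four_point_simple:
  assumes X: "four_point X" "{r, v, u, w, a} \<subseteq> X"
    and deep: "dist r u \<le> dist r w" "dist r w \<le> dist r v" "dist r a \<le> dist r v"
    and nb: "dist u v \<le> \<delta>" "dist w v \<le> \<delta>" "dist a w \<le> \<delta>"
  shows "dist a u \<le> \<delta>"
proof -
  have uw: "dist u w \<le> \<delta>"
    using four_point_simplicial[of X r v u w \<delta>] assms by simp
  show ?thesis
    using four_pointD[OF X(1), of u a r w] four_pointD[OF X(1), of u a r v] four_pointD[OF X(1), of a v w r]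
      uw assms by (auto simp: dist_commute)
qed

lemma ex_deepest:
  assumes "finite I" "i \<in> I"
  obtains v where "v \<in> I" "\<And>u. u \<in> I \<Longrightarrow> dist r (\<rho> u :: 'a::metric_space) \<le> dist r (\<rho> v)"
proof -
  have fin: "finite ((\<lambda>u. dist r (\<rho> u)) ` I)" using assms by simp
  have "Max ((\<lambda>u. dist r (\<rho> u)) ` I) \<in> (\<lambda>u. dist r (\<rho> u)) ` I"
    using Max_in[OF fin] assms by blast
  then obtain v where "v \<in> I" "Max ((\<lambda>u. dist r (\<rho> u)) ` I) = dist r (\<rho> v)" by auto
  with Max_ge[OF fin] show thesis by (metis imageI that)
qed

lemma four_point_chordal:
  assumes X: "four_point X" and G: "unit_ball_graph X G"
  shows "chordal G"
  unfolding chordal_def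
proof (intro allI impI notI)
  fix n :: nat assume n: "n \<ge> 4" and copy: "has_induced_copy G (cycle_graph n)"
  obtain \<delta> \<rho> where "\<delta> > 0" and \<rho>: "\<rho> \<in> {..<n} \<rightarrow> X"
    and adj: "\<And>i j. i < n \<Longrightarrow> j < n \<Longrightarrow> i \<noteq> j \<Longrightarrow> cyclic_neighbours n i j \<longleftrightarrow> dist (\<rho> i) (\<rho> j) \<le> \<delta>"
    by (rule has_induced_copy_unit_ball_graph[OF G copy]) (auto simp: cycle_graph_def)
  \<comment> \<open>The realization of vertex 0 is an arbitrary choice of base point.\<close>
  obtain v where v: "v < n" "\<And>u. u < n \<Longrightarrow> dist (\<rho> 0) (\<rho> u) \<le> dist (\<rho> 0) (\<rho> v)"
    by (rule ex_deepest[of "{..<n}" 0 "\<rho> 0" \<rho>]) (use n in auto)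
  \<comment> \<open>The two neighbours of \<open>v\<close> around the cycle;
    \<open>n \<ge> 4\<close> makes them distinct and non-adjacent, while depth of \<open>v\<close>
    makes them adjacent.\<close>
  define u where "u = (if v = 0 then n - 1 else v - 1)"
  define w where "w = (if Suc v = n then 0 else Suc v)"
  have uw: "u < n" "w < n" "u \<noteq> v" "w \<noteq> v" "u \<noteq> w" "cyclic_neighbours n u v" "cyclic_neighbours n w v"
    "\<not> cyclic_neighbours n u w"
    using n v(1) by (auto simp: cyclic_neighbours_iff u_def w_def)
  have "dist (\<rho> u) (\<rho> w) \<le> \<delta>"
    by (rule four_point_simplicial[OF X, of "\<rho> 0" "\<rho> v"]) (use uw v n \<rho> adj in auto)
  with adj[of u w] uw show False by simp
qed

lemma four_point_sun_free:
  assumes X: "four_point X" and G: "unit_ball_graph X G"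
  shows "sun_free G"
  unfolding sun_free_def
proof (intro allI impI notI)
  fix n :: nat assume n: "n \<ge> 3" and copy: "has_induced_copy G (sun_graph n)"
  define N where "N = 2 * n"
  have N: "N \<ge> 6" "even N" using n by (auto simp: N_def)
  obtain \<delta> \<rho> where "\<delta> > 0" and \<rho>: "\<rho> \<in> {..<N} \<rightarrow> X"
    and adj: "\<And>i j. i < N \<Longrightarrow> j < N \<Longrightarrow> i \<noteq> j \<Longrightarrow>
      (even i \<and> even j \<or> (odd i \<and> even j \<or> even i \<and> odd j) \<and> cyclic_neighbours N i j) \<longleftrightarrow>
      dist (\<rho> i) (\<rho> j) \<le> \<delta>"
    by (rule has_induced_copy_unit_ball_graph[OF G copy]) (auto simp: sun_graph_def N_def)
  obtain v where v: "v < N" "\<And>u. u < N \<Longrightarrow> dist (\<rho> 0) (\<rho> u) \<le> dist (\<rho> 0) (\<rho> v)"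
    by (rule ex_deepest[of "{..<N}" 0 "\<rho> 0" \<rho>]) (use N in auto)
  define prv where "prv i = (if i = 0 then N - 1 else i - 1)" for i
  define nxt where "nxt i = (if Suc i = N then 0 else Suc i)" for i
  have pn: "prv i < N" "nxt i < N" "prv i \<noteq> i" "nxt i \<noteq> i" "even (prv i) \<longleftrightarrow> odd i" "even (nxt i) \<longleftrightarrow> odd i"
    "cyclic_neighbours N (prv i) i" "cyclic_neighbours N (nxt i) i"  if "i < N" for i
    using that N by (auto simp: prv_def nxt_def cyclic_neighbours_iff)
  \<comment> \<open>Since \<open>N \<ge> 6\<close>, the vertices two steps before and one step after
    \<open>v\<close> are three steps apart in one direction and at least three in the other.\<close>
  have *: "prv v \<noteq> nxt v" "prv (prv v) \<noteq> nxt v" "nxt (nxt v) \<noteq> prv v"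
    "\<not> cyclic_neighbours N (prv (prv v)) (nxt v)" "\<not> cyclic_neighbours N (nxt (nxt v)) (prv v)"
    using v(1) N by (auto simp: prv_def nxt_def cyclic_neighbours_iff split: if_splits)
  have nb: "dist (\<rho> (prv v)) (\<rho> v) \<le> \<delta>" "dist (\<rho> (nxt v)) (\<rho> v) \<le> \<delta>"
    using adj[of "prv v" v] adj[of "nxt v" v] pn[OF v(1)] v(1) by auto
  show False
  proof (cases "even v")
    case True
    have "dist (\<rho> (prv v)) (\<rho> (nxt v)) \<le> \<delta>"
      by (rule four_point_simplicial[OF X, of "\<rho> 0" "\<rho> v"]) (use nb pn v \<rho> N in auto)
    then show False
      using adj[of "prv v" "nxt v"] pn[OF v(1)] * True by auto
  next
    case False
    have nb2: "dist (\<rho> (prv (prv v))) (\<rho> (prv v)) \<le> \<delta>" "dist (\<rho> (nxt (nxt v))) (\<rho> (nxt v)) \<le> \<delta>"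
      using adj[of "prv (prv v)" "prv v"] adj[of "nxt (nxt v)" "nxt v"] pn[OF v(1)]
        pn[of "prv v"] pn[of "nxt v"] by auto
    have far: "\<not> dist (\<rho> (prv (prv v))) (\<rho> (nxt v)) \<le> \<delta>" "\<not> dist (\<rho> (nxt (nxt v))) (\<rho> (prv v)) \<le> \<delta>"
      using adj[of "prv (prv v)" "nxt v"] adj[of "nxt (nxt v)" "prv v"] pn[OF v(1)] *
        pn[of "prv v"] pn[of "nxt v"] False by auto
    \<comment> \<open>Here \<open>prv v\<close> and \<open>nxt v\<close> are clique vertices, each
      with an odd neighbour that the other lacks. The one closer to the base point would have to see
      the odd neighbour of the other.\<close>
    consider "dist (\<rho> 0) (\<rho> (prv v)) \<le> dist (\<rho> 0) (\<rho> (nxt v))"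
      | "dist (\<rho> 0) (\<rho> (nxt v)) \<le> dist (\<rho> 0) (\<rho> (prv v))" by linarith
    then show False
    proof cases
      case 1
      have "dist (\<rho> (nxt (nxt v))) (\<rho> (prv v)) \<le> \<delta>"
        by (rule four_point_simple[OF X, of "\<rho> 0" "\<rho> v" _ "\<rho> (nxt v)"])
           (use 1 nb nb2 pn v \<rho> N in auto)
      with far show False by simp
    next
      case 2
      have "dist (\<rho> (prv (prv v))) (\<rho> (nxt v)) \<le> \<delta>"
        by (rule four_point_simple[OF X, of "\<rho> 0" "\<rho> v" _ "\<rho> (prv v)"])
           (use 2 nb nb2 pn v \<rho> N in auto)
      with far show False by simp
    qed
  qed
qed

section \<open>Arcs, geodesics and gates in \<real>-trees\<close>

lemma joined_by_arc_iff:
  "joined_by_arc X x y A \<longleftrightarrow>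
    (\<exists>(a::real) b f. a \<le> b \<and> continuous_on {a..b} f \<and> inj_on f {a..b} \<and> f ` {a..b} \<subseteq> X \<and>
       f a = x \<and> f b = y \<and> A = f ` {a..b})"
proof -
  have "embedding_map (top_of_set {a..b}) (top_of_set X) f \<longleftrightarrow>
      continuous_on {a..b} f \<and> inj_on f {a..b} \<and> f ` {a..b} \<subseteq> X" for a b :: real and f :: "real \<Rightarrow> 'a"
  proof
    assume f: "embedding_map (top_of_set {a..b}) (top_of_set X) f"
    then have "continuous_map (top_of_set {a..b}) (top_of_set X) f" "inj_on f {a..b}"
      by (auto simp: embedding_map_def homeomorphic_eq_everything_map continuous_map_in_subtopology
        subtopology_subtopology inf.absorb2)
    then show "continuous_on {a..b} f \<and> inj_on f {a..b} \<and> f ` {a..b} \<subseteq> X"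
      by auto
  next
    assume f: "continuous_on {a..b} f \<and> inj_on f {a..b} \<and> f ` {a..b} \<subseteq> X"
    show "embedding_map (top_of_set {a..b}) (top_of_set X) f"
      by (rule continuous_imp_embedding_map)
         (use f in \<open>auto simp: compact_space_subtopology Hausdorff_space_subtopology\<close>)
  qed
  then show ?thesis
    unfolding joined_by_arc_def by (metis (no_types, lifting))
qed

lemma
  assumes "geodesic X x y \<gamma>"
  shows geodesic_dist: "\<And>s t. s \<in> {0..dist x y} \<Longrightarrow> t \<in> {0..dist x y} \<Longrightarrow> dist (\<gamma> s) (\<gamma> t) = \<bar>s - t\<bar>"
    and geodesic_0: "\<gamma> 0 = x" and geodesic_end: "\<gamma> (dist x y) = y"
    and geodesic_image: "\<gamma> ` {0..dist x y} \<subseteq> X"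
    and geodesic_mem: "\<And>s. s \<in> {0..dist x y} \<Longrightarrow> \<gamma> s \<in> X"
  using assms by (auto simp: geodesic_def dist_real_def)

lemma geodesic_inj_on: "geodesic X x y \<gamma> \<Longrightarrow> inj_on \<gamma> {0..dist x y}"
  by (rule inj_onI) (metis geodesic_dist abs_eq_0 dist_self eq_iff_diff_eq_0)

lemma geodesic_continuous_on: "geodesic X x y \<gamma> \<Longrightarrow> continuous_on {0..dist x y} \<gamma>"
  unfolding continuous_on_iff by (metis geodesic_dist dist_real_def)

lemma joined_by_arc_geodesic:
  assumes "geodesic X x y \<gamma>"
  shows "joined_by_arc X x y (\<gamma> ` {0..dist x y})"
  unfolding joined_by_arc_iff
  using geodesic_continuous_on[OF assms] geodesic_inj_on[OF assms] geodesic_image[OF assms]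
    geodesic_0[OF assms] geodesic_end[OF assms] zero_le_dist by metis

text \<open>The point \<open>\<sigma> t\<close> lies on every geodesic from \<open>y\<close> to the
  segment, so distances from \<open>y\<close> to the segment become arithmetic in one
  parameter.\<close>

lemma geodesic_gate:
  assumes X: "real_tree X" and \<sigma>: "geodesic X x z \<sigma>" and xyz: "x \<in> X" "y \<in> X" "z \<in> X"
  obtains t where "t \<in> {0..dist x z}"
    "\<And>s. s \<in> {0..dist x z} \<Longrightarrow> dist y (\<sigma> s) = dist y (\<sigma> t) + \<bar>s - t\<bar>"
proof -
  let ?I = "{0..dist x z}"
  have geo: "\<exists>\<gamma>. geodesic X p q \<gamma>" if "p \<in> X" "q \<in> X" for p q
    using X that by (auto simp: real_tree_def geodesic_space_def)
  have unique: "A = B" if "joined_by_arc X p q A" "joined_by_arc X p q B" "p \<in> X" "q \<in> X" for p q A B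
    using X that unfolding real_tree_def uniquely_arc_connected_def by metis
  obtain \<alpha> where \<alpha>: "geodesic X y x \<alpha>" using geo xyz by blast
  have cont: "continuous_on {0..dist y x} \<alpha>" "continuous_on ?I \<sigma>"
    using \<alpha> \<sigma> geodesic_continuous_on by blast+
  \<comment> \<open>The times at which \<alpha> is on the segment. This set is compact and contains
    the end time, where \<alpha> reaches \<open>x = \<sigma> 0\<close>, so there is a first such
    time \<tau>.\<close>
  define K where "K = {0..dist y x} \<inter> \<alpha> -` (\<sigma> ` ?I)"
  have "compact (\<sigma> ` ?I)"
    using cont(2) compact_continuous_image by blast
  then have "closed K"
    unfolding K_def using cont(1) by (intro continuous_closed_preimage compact_imp_closed) auto
  then have "compact K"
    unfolding K_def by (metis Int_absorb1 Int_lower1 closed_Int_compact compact_Icc inf_commute)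
  moreover have "dist y x \<in> K"
    using geodesic_end[OF \<alpha>] geodesic_0[OF \<sigma>] by (auto simp: K_def image_iff intro!: bexI[of _ 0])
  ultimately obtain \<tau> where \<tau>: "\<tau> \<in> K" "\<And>r. r \<in> K \<Longrightarrow> \<tau> \<le> r"
    using compact_attains_inf[of K] by auto
  then obtain t where t: "t \<in> ?I" "\<alpha> \<tau> = \<sigma> t"
    by (auto simp: K_def)
  have \<tau>_range: "\<tau> \<in> {0..dist y x}" using \<tau> by (simp add: K_def)
  show thesis
  proof
    show "t \<in> ?I" by fact
    fix s assume s: "s \<in> ?I"
    \<comment> \<open>From time \<tau> on, \<open>c\<close> moves at unit speed from
      \<open>t\<close> to \<open>s\<close>, in the direction of the sign; for \<open>s = t\<close>
      the path \<open>h\<close> ends at \<tau>.\<close>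
    define c where "c r = t + sgn (s - t) * (r - \<tau>)" for r
    define h where "h r = (if r \<le> \<tau> then \<alpha> r else \<sigma> (c r))" for r
    define e where "e = \<tau> + \<bar>s - t\<bar>"
    have c_range: "c r \<in> ?I" if "r \<in> {\<tau>..e}" for r
      using that s t(1) by (auto simp: c_def e_def sgn_if split: if_splits)
    have [simp]: "c \<tau> = t" "c e = s"
      by (auto simp: c_def e_def sgn_if)
    have "joined_by_arc X y (\<sigma> s) (h ` {0..e})"
      unfolding joined_by_arc_iff
    proof (intro exI conjI)
      show "0 \<le> e" using \<tau>_range by (simp add: e_def)
      have "continuous_on ({0..\<tau>} \<union> {\<tau>..e}) h"
        unfolding h_def
      proof (rule continuous_on_If)
        show "continuous_on {0..\<tau>} \<alpha>"
          using cont(1) by (rule continuous_on_subset) (use \<tau>_range in auto)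
        show "continuous_on {\<tau>..e} (\<lambda>r. \<sigma> (c r))"
          using c_range
          by (intro continuous_on_compose2[OF cont(2)]) (auto simp: c_def intro!: continuous_intros)
      qed (use t in auto)
      moreover have "{0..\<tau>} \<union> {\<tau>..e} = {0..e}"
        using \<tau>_range by (auto simp: e_def)
      ultimately show "continuous_on {0..e} h" by simp
      show "inj_on h {0..e}"
      proof (rule linorder_inj_onI')
        fix q r assume qr: "q \<in> {0..e}" "r \<in> {0..e}" "q < r"
        consider "r \<le> \<tau>" | "q \<le> \<tau>" "\<tau> < r" | "\<tau> < q" using qr by linarith
        then show "h q \<noteq> h r"
        proof cases
          case 1
          then show ?thesis
            using inj_onD[OF geodesic_inj_on[OF \<alpha>], of q r] qr \<tau>_range by (auto simp: h_def)
        next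
          case 2
          have r: "c r \<in> ?I" "c r \<noteq> t"
            using c_range[of r] qr 2 by (auto simp: c_def e_def sgn_if split: if_splits)
          show ?thesis
          proof
            assume "h q = h r"
            then have *: "\<alpha> q = \<sigma> (c r)" using 2 by (simp add: h_def)
            \<comment> \<open>Minimality of \<tau> leaves only \<open>q = \<tau>\<close>, and then
              injectivity of \<sigma> contradicts \<open>c r \<noteq> t\<close>.\<close>
            then have "q \<in> K" using r qr 2 \<tau>_range by (auto simp: K_def)
            with \<tau> 2 have "q = \<tau>" by fastforce
            with * t r inj_onD[OF geodesic_inj_on[OF \<sigma>], of "c r" t] show False by auto
          qed
        next
          case 3
          have "c q \<noteq> c r" using qr 3 by (auto simp: c_def e_def sgn_if split: if_splits)
          then show ?thesis
            using inj_onD[OF geodesic_inj_on[OF \<sigma>], of "c q" "c r"] c_range[of q] c_range[of r] qr 3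
            by (auto simp: h_def)
        qed
      qed
      show "h ` {0..e} \<subseteq> X"
        using geodesic_mem[OF \<alpha>] geodesic_mem[OF \<sigma> c_range] \<tau>_range by (auto simp: h_def)
      show "h 0 = y" using \<tau>_range geodesic_0[OF \<alpha>] by (auto simp: h_def)
      show "h e = \<sigma> s" using t \<open>c e = s\<close> by (auto simp: h_def e_def)
    qed auto
    moreover have "\<sigma> s \<in> X" using geodesic_mem[OF \<sigma> s] .
    moreover obtain \<beta> where \<beta>: "geodesic X y (\<sigma> s) \<beta>" using geo xyz \<open>\<sigma> s \<in> X\<close> by blast
    \<comment> \<open>Uniqueness of arcs puts \<open>\<sigma> t\<close>, a point of the
      concatenation, on the geodesic \<beta>, along which distances add up.\<close>
    ultimately have "h ` {0..e} = \<beta> ` {0..dist y (\<sigma> s)}"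
      using unique joined_by_arc_geodesic xyz by blast
    moreover have "\<sigma> t = h \<tau>" "\<tau> \<in> {0..e}"
      using t \<tau>_range by (auto simp: h_def e_def)
    ultimately obtain r where r: "r \<in> {0..dist y (\<sigma> s)}" "\<sigma> t = \<beta> r"
      by (metis imageE imageI)
    have "dist y (\<sigma> t) = r" "dist (\<sigma> t) (\<sigma> s) = dist y (\<sigma> s) - r"
      using geodesic_dist[OF \<beta>, of 0 r] geodesic_dist[OF \<beta>, of r "dist y (\<sigma> s)"] r
        geodesic_0[OF \<beta>] geodesic_end[OF \<beta>] by auto
    then show "dist y (\<sigma> s) = dist y (\<sigma> t) + \<bar>s - t\<bar>"
      using geodesic_dist[OF \<sigma> t(1) s] by auto
  qed
qed

text \<open>Let \<open>s\<close> and \<open>t\<close> be the gate parameters of \<open>z\<close> and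
  \<open>w\<close> on a geodesic from \<open>x\<close> to \<open>y\<close>. The path through both
  gates bounds \<open>dist z w\<close>, and the distances to \<open>x\<close> and \<open>y\<close>
  are exact; the bound is \<open>dist x w + dist y z\<close> if \<open>s \<le> t\<close> and
  \<open>dist x z + dist y w\<close> otherwise.\<close>

lemma real_tree_four_point:
  assumes X: "real_tree X"
  shows "four_point X"
  unfolding four_point_def
proof (intro ballI)
  fix x y z w assume xyzw: "x \<in> X" "y \<in> X" "z \<in> X" "w \<in> X"
  obtain \<sigma> where \<sigma>: "geodesic X x y \<sigma>"
    using X xyzw by (auto simp: real_tree_def geodesic_space_def)
  obtain s where s: "s \<in> {0..dist x y}"
    "\<And>r. r \<in> {0..dist x y} \<Longrightarrow> dist z (\<sigma> r) = dist z (\<sigma> s) + \<bar>r - s\<bar>"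
    using geodesic_gate[OF X \<sigma>] xyzw by metis
  obtain t where t: "t \<in> {0..dist x y}"
    "\<And>r. r \<in> {0..dist x y} \<Longrightarrow> dist w (\<sigma> r) = dist w (\<sigma> t) + \<bar>r - t\<bar>"
    using geodesic_gate[OF X \<sigma>] xyzw by metis
  have "dist z w \<le> dist z (\<sigma> s) + \<bar>s - t\<bar> + dist w (\<sigma> t)"
    using dist_triangle[of z w "\<sigma> s"] dist_commute[of "\<sigma> s" w] t(2)[OF s(1)] by simp
  moreover have "dist z x = dist z (\<sigma> s) + s" "dist w x = dist w (\<sigma> t) + t"
    "dist z y = dist z (\<sigma> s) + (dist x y - s)" "dist w y = dist w (\<sigma> t) + (dist x y - t)"
    using s(2)[of 0] s(2)[of "dist x y"] t(2)[of 0] t(2)[of "dist x y"] s(1) t(1)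
      geodesic_0[OF \<sigma>] geodesic_end[OF \<sigma>] by auto
  ultimately show "dist x y + dist z w \<le> max (dist x z + dist y w) (dist x w + dist y z)"
    by (auto simp: dist_commute abs_if max_def split: if_splits)
qed

section \<open>From chordality to unique arcs\<close>

lemma connected_chain:
  fixes S :: "'a::metric_space set"
  assumes "topological_space_class.connected T" "T \<subseteq> S" "\<not> {u, v} \<subseteq> T" "\<delta> > 0" "a \<in> T" "b \<in> T"
  shows "(a, b) \<in> {(p, q). p \<in> S \<and> q \<in> S \<and> dist p q \<le> \<delta> \<and> {p, q} \<noteq> {u, v}}\<^sup>*" (is "_ \<in> ?R\<^sup>*")
proof -
  have "sym (?R\<^sup>*)"
    by (rule sym_rtrancl) (auto simp: sym_def dist_commute insert_commute)
  \<comment> \<open>Points of \<open>T\<close> closer than \<delta> are one step apart, as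
    \<open>T\<close> does not contain both \<open>u\<close> and \<open>v\<close>. Hence classes are
    open in \<open>T\<close>, and connectedness leaves a single class.\<close>
  show ?thesis
  proof (rule connected_equivalence_relation[OF assms(1), where R = "\<lambda>a b. (a, b) \<in> ?R\<^sup>*"])
    show "\<exists>U. openin (top_of_set T) U \<and> c \<in> U \<and> (\<forall>x\<in>U. (c, x) \<in> ?R\<^sup>*)" if "c \<in> T" for c
    proof (intro exI conjI ballI)
      show "openin (top_of_set T) (T \<inter> ball c \<delta>)" by (simp add: openin_open_Int)
      show "c \<in> T \<inter> ball c \<delta>" using that assms by simp
      show "(c, x) \<in> ?R\<^sup>*" if "x \<in> T \<inter> ball c \<delta>" for x
        using that \<open>c \<in> T\<close> assms by (intro r_into_rtrancl) auto
    qed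
  qed (use assms \<open>sym (?R\<^sup>*)\<close> in \<open>auto dest: symD intro: rtrancl_trans\<close>)
qed

text \<open>A shortest chain from \<open>u\<close> to \<open>v\<close> that avoids the edge \<open>uv\<close> closes up to an induced cycle of
  the unit ball graph on its points, unless it has length 2.\<close>

lemma chordal_common_neighbour:
  fixes X :: "'a::metric_space set"
  assumes chordal: "\<forall>G :: 'v::infinite pair_pre_digraph. unit_ball_graph X G \<longrightarrow> chordal G"
    and S: "S \<subseteq> X" and \<delta>: "\<delta> > 0" and uv: "u \<noteq> v" "dist u v \<le> \<delta>"
    and chain: "(u, v) \<in> {(p, q). p \<in> S \<and> q \<in> S \<and> dist p q \<le> \<delta> \<and> {p, q} \<noteq> {u, v}}\<^sup>*"
  obtains w where "w \<in> S" "w \<noteq> u" "w \<noteq> v" "dist u w \<le> \<delta>" "dist w v \<le> \<delta>"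
proof -
  define R where "R = {(p, q). p \<in> S \<and> q \<in> S \<and> dist p q \<le> \<delta> \<and> {p, q} \<noteq> {u, v}}"
  have "\<exists>n. (u, v) \<in> R ^^ n"
    using chain unfolding R_def[symmetric] by (rule rtrancl_imp_relpow)
  then obtain n where n: "(u, v) \<in> R ^^ n" "\<And>m. (u, v) \<in> R ^^ m \<Longrightarrow> n \<le> m"
    using LeastI_ex[of "\<lambda>n. (u, v) \<in> R ^^ n"] Least_le[of "\<lambda>n. (u, v) \<in> R ^^ n"] by blast
  obtain f where f: "f 0 = u" "f n = v" and step: "\<And>i. i < n \<Longrightarrow> (f i, f (Suc i)) \<in> R"
    using n(1) unfolding relpow_fun_conv by blast
  have segment: "(f i, f j) \<in> R ^^ (j - i)" if "i \<le> j" "j \<le> n" for i j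
    unfolding relpow_fun_conv using step that by (intro exI[of _ "\<lambda>k. f (i + k)"]) auto
  \<comment> \<open>By minimality of \<open>n\<close>, no stretch can be replaced by fewer steps.
    Below, \<open>k = 0\<close> gives distinct points and \<open>k = 1\<close> excludes
    chords.\<close>
  have shortcut: "j \<le> i + k" if "i \<le> j" "j \<le> n" "(f i, f j) \<in> R ^^ k" for i j k
  proof -
    have "(u, v) \<in> R ^^ (i + k + (n - j))"
      using relpow_trans[OF relpow_trans[OF segment[of 0 i] that(3)] segment[of j n]] that f by simp
    with n(2) that show ?thesis by fastforce
  qed
  have inj: "f i \<noteq> f j" if "i < j" "j \<le> n" for i j
    using shortcut[of i j 0] that by auto
  have n2: "n \<ge> 2"
  proof -
    have "n \<noteq> 0" using f uv by (metis (full_types))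
    moreover have "n \<noteq> 1" using step[of 0] f by (auto simp: R_def)
    ultimately show ?thesis by linarith
  qed
  have fS: "f i \<in> S" if "i \<le> n" for i
    using step[of i] step[of "i - 1"] that n2 by (cases "i < n") (auto simp: R_def)
  \<comment> \<open>The only close pair outside \<open>R\<close> is \<open>u\<close>,
    \<open>v\<close> itself: the closing edge of the cycle.\<close>
  have adj: "dist (f i) (f j) \<le> \<delta> \<longleftrightarrow> j = Suc i \<or> i = 0 \<and> j = n" if "i < j" "j \<le> n" for i j
  proof
    assume d: "dist (f i) (f j) \<le> \<delta>"
    show "j = Suc i \<or> i = 0 \<and> j = n"
    proof (cases "(f i, f j) \<in> R")
      case True
      then show ?thesis using shortcut[of i j 1] that by simp
    next
      case False
      then have "{f i, f j} = {u, v}"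
        using d fS that by (auto simp: R_def)
      then have "f i = f 0 \<and> f j = f n \<or> f i = f n \<and> f j = f 0"
        by (auto simp: doubleton_eq_iff f)
      then show ?thesis
        using inj[of 0 i] inj[of j n] inj[of i n] that by fastforce
    qed
  qed (use step[of i] uv f that in \<open>auto simp: R_def\<close>)
  have "n = 2"
  proof (rule ccontr)
    assume "n \<noteq> 2"
    with n2 have n3: "n \<ge> 3" by simp
    \<comment> \<open>The points \<open>f 0\<close>, ..., \<open>f n\<close> number
      \<open>n + 1\<close>, so \<open>n \<ge> 3\<close> yields an induced cycle of length at least
      4.\<close>
    have "\<exists>G :: 'v pair_pre_digraph. unit_ball_graph X G \<and> has_induced_copy G (cycle_graph (Suc n))"
    proof (rule unit_ball_graph_with_copy[OF pair_graph_cycle_graph \<delta>])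
      show "Suc n \<ge> 2" using n2 by simp
      show "f \<in> pverts (cycle_graph (Suc n)) \<rightarrow> X"
        using fS S by (auto simp: cycle_graph_def)
      fix i j assume "i \<in> pverts (cycle_graph (Suc n))" "j \<in> pverts (cycle_graph (Suc n))" "i \<noteq> j"
      then show "(i, j) \<in> parcs (cycle_graph (Suc n)) \<longleftrightarrow> dist (f i) (f j) \<le> \<delta>"
        using adj[of i j] adj[of j i]
        by (cases i j rule: linorder_cases) (auto simp: cycle_graph_def cyclic_neighbours_iff dist_commute)
    qed blast
    then show False
      using chordal n3 unfolding chordal_def by fastforce
  qed
  show thesis
  proof
    show "f 1 \<in> S" "f 1 \<noteq> u" "f 1 \<noteq> v" "dist u (f 1) \<le> \<delta>" "dist (f 1) v \<le> \<delta>"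
      using fS[of 1] inj[of 0 1] inj[of 1 n] adj[of 0 1] adj[of 1 n] f \<open>n = 2\<close> by auto
  qed
qed

text \<open>Connectedness of \<open>C\<close> supplies chains of short steps, closedness a positive
  distance from a missed point. The application takes an arc from \<open>x\<close> to
  \<open>y\<close> for \<open>C\<close>.\<close>

lemma chordal_geodesic_subset:
  fixes X :: "'a::metric_space set"
  assumes chordal: "\<forall>G :: 'v::infinite pair_pre_digraph. unit_ball_graph X G \<longrightarrow> chordal G"
    and \<gamma>: "geodesic X x y \<gamma>" and C: "topological_space_class.connected C" "closed C" "C \<subseteq> X" "x \<in> C" "y \<in> C"
  shows "\<gamma> ` {0..dist x y} \<subseteq> C"
proof (rule ccontr)
  assume "\<not> \<gamma> ` {0..dist x y} \<subseteq> C"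
  then obtain t where t: "t \<in> {0..dist x y}" "\<gamma> t \<notin> C" by blast
  then have "t \<noteq> dist x y" using geodesic_end[OF \<gamma>] C by auto
  obtain \<epsilon> where \<epsilon>: "\<epsilon> > 0" "ball (\<gamma> t) \<epsilon> \<subseteq> - C"
    using open_contains_ball[of "- C"] C(2) t(2) by (auto simp: open_Compl)
  \<comment> \<open>Halving \<epsilon> keeps \<open>C\<close> farther than \<delta> from
    \<open>\<gamma> t\<close>; the other bound keeps \<open>t + \<delta>\<close> in the domain of
    \<gamma>.\<close>
  define \<delta> where "\<delta> = min (\<epsilon> / 2) (dist x y - t)"
  have \<delta>: "0 < \<delta>" "\<delta> < \<epsilon>" "t + \<delta> \<le> dist x y"
    using \<epsilon> t \<open>t \<noteq> dist x y\<close> by (auto simp: \<delta>_def)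
  define u where "u = \<gamma> t"
  define v where "v = \<gamma> (t + \<delta>)"
  \<comment> \<open>The stretch of \<gamma> strictly between \<open>u\<close> and \<open>v\<close>
    is cut out, as its points are close to both. The detour runs back along \<gamma> to
    \<open>x\<close>, through \<open>C\<close> to \<open>y\<close>, and back along \<gamma> to
    \<open>v\<close>.\<close>
  define S where "S = C \<union> \<gamma> ` {0..t} \<union> \<gamma> ` {t + \<delta>..dist x y}"
  define R where "R = {(p, q). p \<in> S \<and> q \<in> S \<and> dist p q \<le> \<delta> \<and> {p, q} \<noteq> {u, v}}"
  have uv: "dist u v = \<delta>"
    using geodesic_dist[OF \<gamma>, of t "t + \<delta>"] t \<delta> by (simp add: u_def v_def)
  have conn: "topological_space_class.connected (\<gamma> ` {0..t})" "topological_space_class.connected (\<gamma> ` {t + \<delta>..dist x y})"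
    using t \<delta> by (auto intro!: connected_continuous_image continuous_on_subset[OF geodesic_continuous_on[OF \<gamma>]])
  have ends: "u \<in> \<gamma> ` {0..t}" "v \<in> \<gamma> ` {t + \<delta>..dist x y}"
    unfolding u_def v_def using t \<delta> by auto
  have "0 \<in> {0..t}" "dist x y \<in> {t + \<delta>..dist x y}"
    using t \<delta> by auto
  then have xy: "x \<in> \<gamma> ` {0..t}" "y \<in> \<gamma> ` {t + \<delta>..dist x y}"
    using geodesic_0[OF \<gamma>] geodesic_end[OF \<gamma>] by (metis imageI)+
  have "\<gamma> r \<noteq> v" if "r \<in> {0..t}" for r
    using inj_onD[OF geodesic_inj_on[OF \<gamma>], of r "t + \<delta>"] that t \<delta> by (auto simp: v_def)
  then have "\<not> {u, v} \<subseteq> \<gamma> ` {0..t}" by blast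
  then have 1: "(u, x) \<in> R\<^sup>*"
    unfolding R_def by (intro connected_chain[OF conn(1)] ends xy \<delta>(1)) (auto simp: S_def)
  have "\<not> {u, v} \<subseteq> C" using t by (simp add: u_def)
  then have 2: "(x, y) \<in> R\<^sup>*"
    unfolding R_def by (intro connected_chain[OF C(1)] C(4,5) \<delta>(1)) (auto simp: S_def)
  have "\<gamma> r \<noteq> u" if "r \<in> {t + \<delta>..dist x y}" for r
    using inj_onD[OF geodesic_inj_on[OF \<gamma>], of r t] that t \<delta> by (auto simp: u_def)
  then have "\<not> {u, v} \<subseteq> \<gamma> ` {t + \<delta>..dist x y}" by blast
  then have 3: "(y, v) \<in> R\<^sup>*"
    unfolding R_def by (intro connected_chain[OF conn(2)] ends xy \<delta>(1)) (auto simp: S_def)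
  from 1 2 3 have "(u, v) \<in> R\<^sup>*" by (blast intro: rtrancl_trans)
  note chain = this[unfolded R_def]
  have "\<gamma> r \<in> X" if "r \<in> {0..t} \<union> {t + \<delta>..dist x y}" for r
    using geodesic_mem[OF \<gamma>, of r] that t \<delta> by auto
  then have SX: "S \<subseteq> X" using C(3) by (auto simp: S_def)
  have "u \<noteq> v" "dist u v \<le> \<delta>" using uv \<delta> by auto
  from chordal_common_neighbour[OF chordal SX \<delta>(1) this chain]
  obtain w where w: "w \<in> S" "w \<noteq> u" "w \<noteq> v" "dist u w \<le> \<delta>" "dist w v \<le> \<delta>" .
  \<comment> \<open>On \<open>C\<close>, \<open>w\<close> is too far from \<open>u\<close>; on the
    part before \<open>u\<close> only \<open>u\<close> is within \<delta> of \<open>v\<close>, and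
    on the part after \<open>v\<close> only \<open>v\<close> is within \<delta> of
    \<open>u\<close>.\<close>
  consider "w \<in> C" | r where "r \<in> {0..t}" "w = \<gamma> r" | r where "r \<in> {t + \<delta>..dist x y}" "w = \<gamma> r"
    using w(1) by (auto simp: S_def)
  then show False
  proof cases
    case 1
    then show False using \<epsilon>(2) w(4) \<delta> by (auto simp: u_def subset_iff)
  next
    case 2
    then have "r = t"
      using geodesic_dist[OF \<gamma>, of r "t + \<delta>"] w(5) t \<delta> by (auto simp: v_def)
    with 2 w(2) show False by (simp add: u_def)
  next
    case 3
    then have "r = t + \<delta>"
      using geodesic_dist[OF \<gamma>, of t r] w(4) t \<delta> by (auto simp: u_def)
    with 3 w(3) show False by (simp add: v_def)
  qed
qed

lemma chordal_real_tree:
  fixes X :: "'a::metric_space set"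
  assumes X: "geodesic_space X"
    and chordal: "\<forall>G :: 'v::infinite pair_pre_digraph. unit_ball_graph X G \<longrightarrow> chordal G"
  shows "real_tree X"
  unfolding real_tree_def uniquely_arc_connected_def
proof (intro conjI ballI X)
  fix x y assume xy: "x \<in> X" "y \<in> X"
  then obtain \<gamma> where \<gamma>: "geodesic X x y \<gamma>"
    using X by (auto simp: geodesic_space_def)
  let ?\<Gamma> = "\<gamma> ` {0..dist x y}"
  show "\<exists>!A. joined_by_arc X x y A"
  proof (rule ex1I[of _ ?\<Gamma>])
    show "joined_by_arc X x y ?\<Gamma>" using \<gamma> by (rule joined_by_arc_geodesic)
    fix A assume "joined_by_arc X x y A"
    then obtain a b :: real and f where ab: "a \<le> b" and f: "continuous_on {a..b} f" "inj_on f {a..b}"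
      and A: "A = f ` {a..b}" "A \<subseteq> X" "f a = x" "f b = y"
      unfolding joined_by_arc_iff by blast
    have compact: "compact A"
      using A f(1) compact_continuous_image by blast
    have "?\<Gamma> \<subseteq> A"
    proof (rule chordal_geodesic_subset[OF chordal \<gamma>])
      show "topological_space_class.connected A" using A f(1) connected_continuous_image connected_Icc by blast
    qed (use A ab compact compact_imp_closed in auto)
    \<comment> \<open>For the reverse inclusion, pull the geodesic back along \<open>f\<close>: a
      connected set of parameters containing both \<open>a\<close> and \<open>b\<close> is all of
      \<open>{a..b}\<close>.\<close>
    have "continuous_on A (the_inv_into {a..b} f)"
      using continuous_on_inv_into[OF f(1) compact_Icc f(2)] A by simp
    moreover have "topological_space_class.connected ?\<Gamma>"
      using connected_continuous_image[OF geodesic_continuous_on[OF \<gamma>]] by simp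
    ultimately have conn: "topological_space_class.connected (the_inv_into {a..b} f ` ?\<Gamma>)"
      using \<open>?\<Gamma> \<subseteq> A\<close> by (meson connected_continuous_image continuous_on_subset)
    have "x \<in> ?\<Gamma>" "y \<in> ?\<Gamma>"
      using geodesic_0[OF \<gamma>] geodesic_end[OF \<gamma>] by (auto simp: image_iff intro: bexI[of _ 0] bexI[of _ "dist x y"])
    moreover have "the_inv_into {a..b} f x = a" "the_inv_into {a..b} f y = b"
      using the_inv_into_f_f[OF f(2)] A ab by auto
    ultimately have "{a..b} \<subseteq> the_inv_into {a..b} f ` ?\<Gamma>"
      using conn connected_contains_Icc by (metis imageI)
    then have "A \<subseteq> f ` the_inv_into {a..b} f ` ?\<Gamma>"
      using A by blast
    also have "\<dots> = ?\<Gamma>"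
    proof -
      have "f (the_inv_into {a..b} f p) = p" if "p \<in> ?\<Gamma>" for p
        using that \<open>?\<Gamma> \<subseteq> A\<close> A f_the_inv_into_f[OF f(2)] by blast
      then have "(\<lambda>p. f (the_inv_into {a..b} f p)) ` ?\<Gamma> = (\<lambda>p. p) ` ?\<Gamma>"
        by (rule image_cong[OF refl])
      then show ?thesis by (simp add: image_image)
    qed
    finally show "A = ?\<Gamma>" using \<open>?\<Gamma> \<subseteq> A\<close> by blast
  qed
qed

(* The vertices are drawn from an arbitrary infinite type 'v (for instance nat), which contains
   a copy of every finite graph. *)
theorem theorem1p9:
  fixes X :: "'a::metric_space set"
  assumes "geodesic_space X"
  shows "((\<forall>G :: 'v::infinite pair_pre_digraph. unit_ball_graph X G \<longrightarrow> strongly_chordal G) \<longleftrightarrow>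
          (\<forall>G :: 'v pair_pre_digraph. unit_ball_graph X G \<longrightarrow> chordal G)) \<and>
         ((\<forall>G :: 'v pair_pre_digraph. unit_ball_graph X G \<longrightarrow> chordal G) \<longleftrightarrow>
          real_tree X)"
  using chordal_real_tree[OF assms] real_tree_four_point four_point_chordal four_point_sun_free
  unfolding strongly_chordal_def by metis

end
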